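(* Let $(M,\kappa)$ be a symplectic manifold, let $J$ be a $\kappa$-calibrated complex structure on $M$, and let $g=g_J$ with Levi-Civita connection $\nabla$. If $(\nabla J)\nabla=0$, i.e. $(\nabla_XJ)(\nabla_YZ)=0$ for all vector fields $X,Y,Z$ on $M$, then $(g,J,\kappa)$ is a Kähler structure on $M$.
   Context: A complex structure on a manifold $M$ means here a smooth section $J$ of $\mathrm{End}(TM)$ with $J^2=-\mathrm{Id}$ (i.e. an almost complex structure; integrability is not assumed). $J$ is integrable if it is induced by a holomorphic structure; equivalently its Nijenhuis tensor $N_J(X,Y)=[JX,JY]-J[JX,Y]-J[X,JY]-[X,Y]$ vanishes. A symplectic manifold is a pair $(M,\kappa)$ with $\kappa$ a closed non-degenerate 2-form. A complex structure $J$ on $(M,\kappa)$ is $\kappa$-calibrated if $\kappa(J\cdot,J\cdot)=\kappa(\cdot,\cdot)$ and $g_J(\cdot,\cdot):=\kappa(J\cdot,\cdot)$ is positive definite. A Kähler structure on $M$ is a triple $(g,J,\kappa)$ where $\kappa$ is a symplectic structure, $J$ is an integrable $\kappa$-calibrated complex structure and $g=g_J$. *)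

theory Defs
  imports "HOL-Analysis.Analysis" "HOL-Library.Function_Algebras"
begin

section \<open>Smooth maps between open subsets of normed spaces\<close>

text \<open>
  Meant for open \<open>S\<close> in a finite-dimensional space. There a differentiable map is \<open>C\<^sup>k\<^sup>+\<^sup>1\<close>
  iff each of its directional derivatives is \<open>C\<^sup>k\<close>.
\<close>

primrec Ck_on :: "nat \<Rightarrow> ('b::real_normed_vector \<Rightarrow> 'c::real_normed_vector) \<Rightarrow> 'b set \<Rightarrow> bool" where
  "Ck_on 0 f S \<longleftrightarrow> continuous_on S f"
| "Ck_on (Suc k) f S \<longleftrightarrow>
     (\<forall>x\<in>S. f differentiable (at x)) \<and>
     (\<forall>v. Ck_on k (\<lambda>x. frechet_derivative f (at x) v) S)"

definition smooth_map_on :: "'b set \<Rightarrow> ('b::real_normed_vector \<Rightarrow> 'c::real_normed_vector) \<Rightarrow> bool" where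
  "smooth_map_on S f \<longleftrightarrow> (\<forall>k. Ck_on k f S)"


section \<open>Smooth manifolds\<close>

text \<open>
  The manifold is a whole type \<open>'a\<close>, Hausdorff and second countable by its type classes,
  together with an atlas of charts \<open>(U, \<phi>)\<close> with values in a finite-dimensional normed
  space \<open>'e\<close>. The class \<open>euclidean_space\<close> is not used for \<open>'e\<close> because it would
  exclude manifolds of dimension 0. The map \<open>\<phi>\<close> is relevant on \<open>U\<close> only.
\<close>

type_synonym ('a, 'e) chart = "'a set \<times> ('a \<Rightarrow> 'e)"

definition is_chart :: "('a::topological_space, 'e::real_normed_vector) chart \<Rightarrow> bool" where
  "is_chart c \<longleftrightarrow> (case c of (U, \<phi>) \<Rightarrow>
     open U \<and> open (\<phi> ` U) \<and> homeomorphism U (\<phi> ` U) \<phi> (inv_into U \<phi>))"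

definition smooth_atlas ::
  "('a::{t2_space, second_countable_topology}, 'e::real_normed_vector) chart set \<Rightarrow> bool" where
  "smooth_atlas A \<longleftrightarrow>
     (\<exists>B :: 'e set. finite B \<and> span B = UNIV) \<and>
     (\<forall>c\<in>A. is_chart c) \<and>
     (\<Union>(U, \<phi>)\<in>A. U) = UNIV \<and>
     (\<forall>(U, \<phi>)\<in>A. \<forall>(V, \<psi>)\<in>A. smooth_map_on (\<phi> ` (U \<inter> V)) (\<psi> \<circ> inv_into U \<phi>))"

definition smooth_fun ::
  "('a::topological_space, 'e::real_normed_vector) chart set \<Rightarrow> ('a \<Rightarrow> real) \<Rightarrow> bool" where
  "smooth_fun A f \<longleftrightarrow> (\<forall>(U, \<phi>)\<in>A. smooth_map_on (\<phi> ` U) (f \<circ> inv_into U \<phi>))"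


section \<open>Tangent vectors and vector fields\<close>

text \<open>
  A tangent vector at \<open>p\<close> is a derivation at \<open>p\<close> of the algebra of smooth functions.
  As it is represented by a functional on all functions, it is set to 0 on non-smooth
  functions, so that equality of tangent vectors is equality of functionals.
  Addition, subtraction and negation of tangent vectors and of vector fields are the
  pointwise ones, and \<open>0\<close> is the zero function.
\<close>

type_synonym 'a tvec = "('a \<Rightarrow> real) \<Rightarrow> real"
type_synonym 'a vfield = "'a \<Rightarrow> 'a tvec"

definition tangent_space ::
  "('a::topological_space, 'e::real_normed_vector) chart set \<Rightarrow> 'a \<Rightarrow> 'a tvec set" where
  "tangent_space A p = {v.
     (\<forall>f h. smooth_fun A f \<longrightarrow> smooth_fun A h \<longrightarrow>
        v (\<lambda>q. f q + h q) = v f + v h \<and>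
        v (\<lambda>q. f q * h q) = v f * h p + f p * v h) \<and>
     (\<forall>c f. smooth_fun A f \<longrightarrow> v (\<lambda>q. c * f q) = c * v f) \<and>
     (\<forall>f. \<not> smooth_fun A f \<longrightarrow> v f = 0)}"

definition vector_fields ::
  "('a::topological_space, 'e::real_normed_vector) chart set \<Rightarrow> 'a vfield set" where
  "vector_fields A = {X.
     (\<forall>p. X p \<in> tangent_space A p) \<and>
     (\<forall>f. smooth_fun A f \<longrightarrow> smooth_fun A (\<lambda>p. X p f))}"

definition tscale :: "real \<Rightarrow> 'a tvec \<Rightarrow> 'a tvec" where
  "tscale c v = (\<lambda>f. c * v f)"

definition fscale :: "('a \<Rightarrow> real) \<Rightarrow> 'a vfield \<Rightarrow> 'a vfield" where
  "fscale f X = (\<lambda>p. tscale (f p) (X p))"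

definition lie_bracket :: "'a vfield \<Rightarrow> 'a vfield \<Rightarrow> 'a vfield" where
  "lie_bracket X Y = (\<lambda>p f. X p (\<lambda>q. Y q f) - Y p (\<lambda>q. X q f))"


section \<open>Sections of the endomorphism bundle and covariant 2-tensors\<close>

text \<open>
  Tensor fields are pointwise multilinear on tangent spaces. Smoothness of such a field means
  that it sends smooth vector fields to smooth objects. Values on arguments outside the
  tangent spaces are irrelevant.
\<close>

type_synonym 'a endo = "'a \<Rightarrow> 'a tvec \<Rightarrow> 'a tvec"
type_synonym 'a tensor2 = "'a \<Rightarrow> 'a tvec \<Rightarrow> 'a tvec \<Rightarrow> real"

definition endo_app :: "'a endo \<Rightarrow> 'a vfield \<Rightarrow> 'a vfield" where
  "endo_app J X = (\<lambda>p. J p (X p))"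

definition smooth_endo ::
  "('a::topological_space, 'e::real_normed_vector) chart set \<Rightarrow> 'a endo \<Rightarrow> bool" where
  "smooth_endo A J \<longleftrightarrow>
     (\<forall>p. \<forall>u\<in>tangent_space A p. J p u \<in> tangent_space A p \<and>
        (\<forall>v\<in>tangent_space A p. J p (u + v) = J p u + J p v) \<and>
        (\<forall>c. J p (tscale c u) = tscale c (J p u))) \<and>
     (\<forall>X\<in>vector_fields A. endo_app J X \<in> vector_fields A)"

definition smooth_tensor2 ::
  "('a::topological_space, 'e::real_normed_vector) chart set \<Rightarrow> 'a tensor2 \<Rightarrow> bool" where
  "smooth_tensor2 A b \<longleftrightarrow>
     (\<forall>p. \<forall>u\<in>tangent_space A p. \<forall>v\<in>tangent_space A p.
        (\<forall>w\<in>tangent_space A p. b p (u + w) v = b p u v + b p w v \<and>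
                                b p u (v + w) = b p u v + b p u w) \<and>
        (\<forall>c. b p (tscale c u) v = c * b p u v \<and> b p u (tscale c v) = c * b p u v)) \<and>
     (\<forall>X\<in>vector_fields A. \<forall>Y\<in>vector_fields A. smooth_fun A (\<lambda>p. b p (X p) (Y p)))"


section \<open>Symplectic, complex and Kaehler structures\<close>

definition two_form ::
  "('a::topological_space, 'e::real_normed_vector) chart set \<Rightarrow> 'a tensor2 \<Rightarrow> bool" where
  "two_form A \<omega> \<longleftrightarrow> smooth_tensor2 A \<omega> \<and> (\<forall>p. \<forall>u\<in>tangent_space A p. \<omega> p u u = 0)"

text \<open>The invariant formula for the exterior derivative of a 2-form.\<close>

definition ext_deriv2 :: "'a tensor2 \<Rightarrow> 'a vfield \<Rightarrow> 'a vfield \<Rightarrow> 'a vfield \<Rightarrow> 'a \<Rightarrow> real" where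
  "ext_deriv2 \<omega> X Y Z p =
     X p (\<lambda>q. \<omega> q (Y q) (Z q)) - Y p (\<lambda>q. \<omega> q (X q) (Z q)) + Z p (\<lambda>q. \<omega> q (X q) (Y q))
     - \<omega> p (lie_bracket X Y p) (Z p) + \<omega> p (lie_bracket X Z p) (Y p)
     - \<omega> p (lie_bracket Y Z p) (X p)"

definition closed_form ::
  "('a::topological_space, 'e::real_normed_vector) chart set \<Rightarrow> 'a tensor2 \<Rightarrow> bool" where
  "closed_form A \<omega> \<longleftrightarrow>
     (\<forall>X\<in>vector_fields A. \<forall>Y\<in>vector_fields A. \<forall>Z\<in>vector_fields A. \<forall>p.
        ext_deriv2 \<omega> X Y Z p = 0)"

definition nondegenerate ::
  "('a::topological_space, 'e::real_normed_vector) chart set \<Rightarrow> 'a tensor2 \<Rightarrow> bool" where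
  "nondegenerate A \<omega> \<longleftrightarrow>
     (\<forall>p. \<forall>u\<in>tangent_space A p. (\<forall>v\<in>tangent_space A p. \<omega> p u v = 0) \<longrightarrow> u = 0)"

definition symplectic_form ::
  "('a::topological_space, 'e::real_normed_vector) chart set \<Rightarrow> 'a tensor2 \<Rightarrow> bool" where
  "symplectic_form A \<kappa> \<longleftrightarrow> two_form A \<kappa> \<and> closed_form A \<kappa> \<and> nondegenerate A \<kappa>"

text \<open>Integrability is not part of the following notion.\<close>

definition complex_structure ::
  "('a::topological_space, 'e::real_normed_vector) chart set \<Rightarrow> 'a endo \<Rightarrow> bool" where
  "complex_structure A J \<longleftrightarrow>
     smooth_endo A J \<and> (\<forall>p. \<forall>u\<in>tangent_space A p. J p (J p u) = - u)"

definition nijenhuis :: "'a endo \<Rightarrow> 'a vfield \<Rightarrow> 'a vfield \<Rightarrow> 'a vfield" where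
  "nijenhuis J X Y =
     lie_bracket (endo_app J X) (endo_app J Y) - endo_app J (lie_bracket (endo_app J X) Y)
     - endo_app J (lie_bracket X (endo_app J Y)) - lie_bracket X Y"

text \<open>
  Integrability is expressed by the vanishing of the Nijenhuis tensor, which by Newlander and
  Nirenberg is equivalent to \<open>J\<close> being induced by a holomorphic structure.
\<close>

definition integrable ::
  "('a::topological_space, 'e::real_normed_vector) chart set \<Rightarrow> 'a endo \<Rightarrow> bool" where
  "integrable A J \<longleftrightarrow> (\<forall>X\<in>vector_fields A. \<forall>Y\<in>vector_fields A. nijenhuis J X Y = 0)"

definition metric_of :: "'a tensor2 \<Rightarrow> 'a endo \<Rightarrow> 'a tensor2" where
  "metric_of \<kappa> J = (\<lambda>p u v. \<kappa> p (J p u) v)"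

definition calibrated ::
  "('a::topological_space, 'e::real_normed_vector) chart set \<Rightarrow> 'a tensor2 \<Rightarrow> 'a endo \<Rightarrow> bool" where
  "calibrated A \<kappa> J \<longleftrightarrow>
     (\<forall>p. \<forall>u\<in>tangent_space A p. \<forall>v\<in>tangent_space A p. \<kappa> p (J p u) (J p v) = \<kappa> p u v) \<and>
     (\<forall>p. \<forall>u\<in>tangent_space A p. u \<noteq> 0 \<longrightarrow> metric_of \<kappa> J p u u > 0)"

definition kaehler_structure ::
  "('a::topological_space, 'e::real_normed_vector) chart set \<Rightarrow>
   'a tensor2 \<Rightarrow> 'a endo \<Rightarrow> 'a tensor2 \<Rightarrow> bool" where
  "kaehler_structure A g J \<kappa> \<longleftrightarrow>
     symplectic_form A \<kappa> \<and>
     complex_structure A J \<and> integrable A J \<and> calibrated A \<kappa> J \<and>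
     (\<forall>p. \<forall>u\<in>tangent_space A p. \<forall>v\<in>tangent_space A p. g p u v = metric_of \<kappa> J p u v)"


section \<open>Connections\<close>

text \<open>\<open>D X Y\<close> is the covariant derivative of \<open>Y\<close> along \<open>X\<close>.\<close>

type_synonym 'a connection = "'a vfield \<Rightarrow> 'a vfield \<Rightarrow> 'a vfield"

definition affine_connection ::
  "('a::topological_space, 'e::real_normed_vector) chart set \<Rightarrow> 'a connection \<Rightarrow> bool" where
  "affine_connection A D \<longleftrightarrow>
     (\<forall>X\<in>vector_fields A. \<forall>Y\<in>vector_fields A. D X Y \<in> vector_fields A \<and>
        (\<forall>Z\<in>vector_fields A. D (X + Z) Y = D X Y + D Z Y \<and> D X (Y + Z) = D X Y + D X Z) \<and>
        (\<forall>f. smooth_fun A f \<longrightarrow>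
           D (fscale f X) Y = fscale f (D X Y) \<and>
           D X (fscale f Y) = fscale f (D X Y) + fscale (\<lambda>p. X p f) Y))"

definition levi_civita ::
  "('a::topological_space, 'e::real_normed_vector) chart set \<Rightarrow>
   'a tensor2 \<Rightarrow> 'a connection \<Rightarrow> bool" where
  "levi_civita A g D \<longleftrightarrow>
     affine_connection A D \<and>
     (\<forall>X\<in>vector_fields A. \<forall>Y\<in>vector_fields A. D X Y - D Y X = lie_bracket X Y) \<and>
     (\<forall>X\<in>vector_fields A. \<forall>Y\<in>vector_fields A. \<forall>Z\<in>vector_fields A. \<forall>p.
        X p (\<lambda>q. g q (Y q) (Z q)) = g p (D X Y p) (Z p) + g p (Y p) (D X Z p))"

text \<open>The covariant derivative of \<open>J\<close> along \<open>X\<close>, applied to the vector field \<open>W\<close>.\<close>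

definition cov_deriv_endo ::
  "'a connection \<Rightarrow> 'a endo \<Rightarrow> 'a vfield \<Rightarrow> 'a vfield \<Rightarrow> 'a vfield" where
  "cov_deriv_endo D J X W = D X (endo_app J W) - endo_app J (D X W)"

end

theory Submission
  imports Defs
begin

text \<open>
  The operator \<open>\<nabla>\<^sub>X J\<close> is linear over the smooth functions, whereas \<open>\<nabla>\<^sub>Y\<close> is not. Replacing \<open>Z\<close> by
  \<open>f Z\<close> in \<open>(\<nabla>\<^sub>X J)(\<nabla>\<^sub>Y Z) = 0\<close> and using the hypothesis for \<open>Z\<close> itself leaves
  \<open>(Y f) (\<nabla>\<^sub>X J) Z = 0\<close>. At a point where some vector field \<open>Y\<close> does not vanish, there is a smooth
  \<open>f\<close> with \<open>Y f \<noteq> 0\<close>, so \<open>(\<nabla>\<^sub>X J) Z\<close> vanishes there; at a point where all vector fields vanish it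
  vanishes anyway. This dichotomy is lemma \<open>parallel_if_kills_derivatives\<close>, and it yields \<open>\<nabla>J = 0\<close>
  from global vector fields alone.

  As \<open>\<nabla>\<close> is torsion-free, all brackets in the Nijenhuis tensor can be expressed by
  \<open>\<nabla>\<close>. Once \<open>J\<close> commutes with all \<open>\<nabla>\<^sub>X\<close> the terms cancel in pairs
  (lemma \<open>integrable_if_parallel\<close>).

  Analysis enters only through the smoothness of products of smooth functions, by which \<open>f Z\<close> is
  again a vector field.
\<close>

section \<open>Products of smooth functions\<close>

text \<open>
  Openness matters: the derivatives of \<open>f\<close> at a point of \<open>S\<close> depend on the values of \<open>f\<close> near
  that point.
\<close>

lemma Ck_on_cong:
  assumes "open S" and "\<And>x. x \<in> S \<Longrightarrow> f x = g x" and "Ck_on k f S"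
  shows "Ck_on k g S"
  using assms(2,3)
proof (induction k arbitrary: f g)
  case 0
  then show ?case by (simp cong: continuous_on_cong)
next
  case (Suc k)
  have deriv: "(g has_derivative frechet_derivative f (at x)) (at x)" if "x \<in> S" for x
    using has_derivative_transform_within_open[OF _ \<open>open S\<close> that Suc.prems(1)] Suc.prems(2) that
    by (auto simp: frechet_derivative_works)
  then have "frechet_derivative g (at x) = frechet_derivative f (at x)" if "x \<in> S" for x
    using frechet_derivative_at[OF deriv[OF that]] by simp
  then have "Ck_on k (\<lambda>x. frechet_derivative g (at x) v) S" for v
    using Suc.IH[of "\<lambda>x. frechet_derivative f (at x) v" "\<lambda>x. frechet_derivative g (at x) v"]
      Suc.prems(2) by simp
  then show ?case
    using deriv by (auto simp: differentiable_def)
qed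

lemma Ck_on_Suc_imp: "Ck_on (Suc k) f S \<Longrightarrow> Ck_on k f S"
proof (induction k arbitrary: f)
  case 0
  then show ?case
    by (auto simp: continuous_at_imp_continuous_on differentiable_imp_continuous_within)
next
  case (Suc k)
  then show ?case by (metis Ck_on.simps(2))
qed

lemma Ck_on_add:
  assumes "open S" and "Ck_on k f S" and "Ck_on k g S"
  shows "Ck_on k (\<lambda>x. f x + g x) S"
  using assms(2,3)
proof (induction k arbitrary: f g)
  case 0
  then show ?case by (simp add: continuous_on_add)
next
  case (Suc k)
  have deriv: "((\<lambda>x. f x + g x) has_derivative
      (\<lambda>v. frechet_derivative f (at x) v + frechet_derivative g (at x) v)) (at x)" if "x \<in> S" for x
    using Suc.prems that by (intro has_derivative_add) (auto simp: frechet_derivative_works)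
  have "Ck_on k (\<lambda>x. frechet_derivative (\<lambda>x. f x + g x) (at x) v) S" for v
  proof (rule Ck_on_cong[OF \<open>open S\<close>])
    show "Ck_on k (\<lambda>x. frechet_derivative f (at x) v + frechet_derivative g (at x) v) S"
      using Suc by simp
  qed (simp add: frechet_derivative_at[OF deriv, symmetric])
  then show ?case using deriv by (auto simp: differentiable_def)
qed

text \<open>
  By Leibniz, the derivative of a product is a sum of products in which one factor has
  lost one order of differentiability; the other one is demoted to the same order.
\<close>

lemma Ck_on_mult:
  fixes f g :: "'b::real_normed_vector \<Rightarrow> 'c::real_normed_algebra"
  assumes "open S" and "Ck_on k f S" and "Ck_on k g S"
  shows "Ck_on k (\<lambda>x. f x * g x) S"
  using assms(2,3)
proof (induction k arbitrary: f g)
  case 0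
  then show ?case by (simp add: continuous_on_mult)
next
  case (Suc k)
  have deriv: "((\<lambda>x. f x * g x) has_derivative
      (\<lambda>v. f x * frechet_derivative g (at x) v + frechet_derivative f (at x) v * g x)) (at x)"
    if "x \<in> S" for x
    using Suc.prems that by (intro has_derivative_mult) (auto simp: frechet_derivative_works)
  have "Ck_on k (\<lambda>x. frechet_derivative (\<lambda>x. f x * g x) (at x) v) S" for v
  proof (rule Ck_on_cong[OF \<open>open S\<close>])
    show "Ck_on k (\<lambda>x. f x * frechet_derivative g (at x) v + frechet_derivative f (at x) v * g x) S"
      using Suc.prems Ck_on_Suc_imp by (intro Ck_on_add \<open>open S\<close> Suc.IH) auto
  qed (simp add: frechet_derivative_at[OF deriv, symmetric])
  then show ?case using deriv by (auto simp: differentiable_def)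
qed

lemma smooth_fun_mult:
  assumes "smooth_atlas A" and "smooth_fun A f" and "smooth_fun A h"
  shows "smooth_fun A (\<lambda>p. f p * h p)"
proof -
  have "open (\<phi> ` U)" if "(U, \<phi>) \<in> A" for U \<phi>
    using assms(1) that by (auto simp: smooth_atlas_def is_chart_def)
  then show ?thesis
    using assms(2,3) by (auto simp: smooth_fun_def smooth_map_on_def comp_def intro!: Ck_on_mult)
qed


section \<open>The module of vector fields\<close>

lemma vector_field_tangent: "X \<in> vector_fields A \<Longrightarrow> X p \<in> tangent_space A p"
  by (simp add: vector_fields_def)

lemma tangent_space_scale: "v \<in> tangent_space A p \<Longrightarrow> tscale c v \<in> tangent_space A p"
  by (auto simp: tangent_space_def tscale_def algebra_simps)

lemma vector_field_fscale:
  assumes "smooth_atlas A" and "smooth_fun A f" and "X \<in> vector_fields A"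
  shows "fscale f X \<in> vector_fields A"
proof -
  have "smooth_fun A (\<lambda>p. f p * X p h)" if "smooth_fun A h" for h
    using assms that by (intro smooth_fun_mult) (auto simp: vector_fields_def)
  moreover have "tscale (f p) (X p) \<in> tangent_space A p" for p
    using assms(3) by (intro tangent_space_scale vector_field_tangent)
  ultimately show ?thesis
    by (simp add: vector_fields_def fscale_def tscale_def)
qed

text \<open>
  A tangent vector is determined by its values on smooth functions, as it is 0 on all others.
\<close>

lemma vector_field_detected:
  assumes "Y \<in> vector_fields A" and "Y p \<noteq> 0"
  obtains f where "smooth_fun A f" and "Y p f \<noteq> 0"
proof -
  obtain f where "Y p f \<noteq> 0"
    using assms(2) by (auto simp: fun_eq_iff)
  moreover from this have "smooth_fun A f"
    using vector_field_tangent[OF assms(1), of p] by (auto simp: tangent_space_def)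
  ultimately show thesis using that by blast
qed

lemma smooth_endo_vector_field:
  "smooth_endo A J \<Longrightarrow> X \<in> vector_fields A \<Longrightarrow> endo_app J X \<in> vector_fields A"
  by (simp add: smooth_endo_def)

lemma endo_app_add:
  assumes "smooth_endo A J" and "X \<in> vector_fields A" and "Y \<in> vector_fields A"
  shows "endo_app J (X + Y) = endo_app J X + endo_app J Y"
proof
  fix p
  show "endo_app J (X + Y) p = (endo_app J X + endo_app J Y) p"
    using assms(1) vector_field_tangent[OF assms(2), of p] vector_field_tangent[OF assms(3), of p]
    by (simp add: endo_app_def smooth_endo_def)
qed

lemma endo_app_fscale:
  assumes "smooth_endo A J" and "X \<in> vector_fields A"
  shows "endo_app J (fscale f X) = fscale f (endo_app J X)"
proof
  fix p
  show "endo_app J (fscale f X) p = fscale f (endo_app J X) p"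
    using assms(1) vector_field_tangent[OF assms(2), of p]
    by (simp add: endo_app_def smooth_endo_def fscale_def)
qed

lemma endo_app_diff:
  assumes J: "smooth_endo A J" and X: "X \<in> vector_fields A" and Y: "Y \<in> vector_fields A"
  shows "endo_app J (X - Y) = endo_app J X - endo_app J Y"
proof
  fix p
  have minus: "- v = tscale (-1) v" for v :: "'a tvec"
    by (auto simp: tscale_def)
  have "J p (X p + tscale (-1) (Y p)) = J p (X p) + tscale (-1) (J p (Y p))"
    using J vector_field_tangent[OF X, of p] vector_field_tangent[OF Y, of p]
      tangent_space_scale[of "Y p" A p "-1"]
    by (simp add: smooth_endo_def)
  then show "endo_app J (X - Y) p = (endo_app J X - endo_app J Y) p"
    by (simp add: endo_app_def minus[symmetric])
qed


section \<open>The covariant derivative of an endomorphism field\<close>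

lemma cov_deriv_endo_add:
  assumes "affine_connection A D" and "smooth_endo A J"
    and "X \<in> vector_fields A" and "V \<in> vector_fields A" and "W \<in> vector_fields A"
  shows "cov_deriv_endo D J X (V + W) = cov_deriv_endo D J X V + cov_deriv_endo D J X W"
proof -
  have add: "D X (P + Q) = D X P + D X Q" and "D X P \<in> vector_fields A"
    if "P \<in> vector_fields A" "Q \<in> vector_fields A" for P Q
    using assms(1,3) that by (auto simp: affine_connection_def)
  then show ?thesis
    using assms
    by (simp add: cov_deriv_endo_def endo_app_add[of A] smooth_endo_vector_field)
qed

text \<open>
  The two terms \<open>(X f) J W\<close> produced by the Leibniz rule cancel.
\<close>

lemma cov_deriv_endo_fscale:
  assumes "smooth_atlas A" and D: "affine_connection A D" and J: "smooth_endo A J"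
    and X: "X \<in> vector_fields A" and W: "W \<in> vector_fields A" and f: "smooth_fun A f"
  shows "cov_deriv_endo D J X (fscale f W) = fscale f (cov_deriv_endo D J X W)"
proof -
  have leibniz: "D X (fscale f P) = fscale f (D X P) + fscale (\<lambda>p. X p f) P"
    if "P \<in> vector_fields A" for P
    using D X that f by (auto simp: affine_connection_def)
  have DW: "D X W \<in> vector_fields A"
    using D X W by (auto simp: affine_connection_def)
  have Xf: "smooth_fun A (\<lambda>p. X p f)"
    using X f by (simp add: vector_fields_def)
  have "endo_app J (D X (fscale f W))
      = fscale f (endo_app J (D X W)) + fscale (\<lambda>p. X p f) (endo_app J W)"
    using vector_field_fscale[OF assms(1) f DW] vector_field_fscale[OF assms(1) Xf W]
    by (simp add: leibniz[OF W] endo_app_add[OF J] endo_app_fscale[OF J] DW W)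
  moreover have "D X (endo_app J (fscale f W))
      = fscale f (D X (endo_app J W)) + fscale (\<lambda>p. X p f) (endo_app J W)"
    using leibniz[OF smooth_endo_vector_field[OF J W]] by (simp add: endo_app_fscale[OF J W])
  ultimately show ?thesis
    by (auto simp: cov_deriv_endo_def fscale_def tscale_def fun_eq_iff algebra_simps)
qed

text \<open>
  If \<open>Z\<close> ranges over a whole module, so does \<open>f Z\<close>, and the failure of \<open>\<nabla>\<^sub>Y\<close> to be linear over
  functions reaches every vector field up to the factor \<open>Y f\<close>.
\<close>

lemma parallel_if_kills_derivatives:
  assumes atlas: "smooth_atlas A" and D: "affine_connection A D" and J: "smooth_endo A J"
    and kills: "\<And>X Y Z. X \<in> vector_fields A \<Longrightarrow> Y \<in> vector_fields A \<Longrightarrow> Z \<in> vector_fields A \<Longrightarrow>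
      cov_deriv_endo D J X (D Y Z) = 0"
    and X: "X \<in> vector_fields A" and Z: "Z \<in> vector_fields A"
  shows "cov_deriv_endo D J X Z = 0"
proof
  fix p
  have D_field: "D P Q \<in> vector_fields A" if "P \<in> vector_fields A" "Q \<in> vector_fields A" for P Q
    using D that by (auto simp: affine_connection_def)
  show "cov_deriv_endo D J X Z p = 0 p"
  proof (cases "\<exists>Y\<in>vector_fields A. Y p \<noteq> 0")
    case True
    then obtain Y f where Y: "Y \<in> vector_fields A" and f: "smooth_fun A f" and "Y p f \<noteq> 0"
      using vector_field_detected by metis
    have Yf: "smooth_fun A (\<lambda>q. Y q f)"
      using Y f by (simp add: vector_fields_def)
    have "0 = cov_deriv_endo D J X (D Y (fscale f Z))"
      using kills[OF X Y vector_field_fscale[OF atlas f Z]] by simp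
    also have "D Y (fscale f Z) = fscale f (D Y Z) + fscale (\<lambda>q. Y q f) Z"
      using D Y Z f by (auto simp: affine_connection_def)
    also have "cov_deriv_endo D J X \<dots>
        = fscale f (cov_deriv_endo D J X (D Y Z)) + fscale (\<lambda>q. Y q f) (cov_deriv_endo D J X Z)"
      using vector_field_fscale[OF atlas f D_field[OF Y Z]] vector_field_fscale[OF atlas Yf Z]
      by (simp add: cov_deriv_endo_add[OF D J X] cov_deriv_endo_fscale[OF atlas D J X]
          D_field[OF Y Z] Z f Yf)
    also have "cov_deriv_endo D J X (D Y Z) = 0"
      using kills X Y Z by blast
    finally have "fscale (\<lambda>q. Y q f) (cov_deriv_endo D J X Z) p = 0"
      by (auto simp: fscale_def tscale_def fun_eq_iff)
    then show ?thesis
      using \<open>Y p f \<noteq> 0\<close> by (auto simp: fscale_def tscale_def fun_eq_iff)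
  next
    case False
    then have zero: "P p = 0" if "P \<in> vector_fields A" for P
      using that by blast
    then show ?thesis
      using zero[OF D_field[OF X smooth_endo_vector_field[OF J Z]]]
        zero[OF smooth_endo_vector_field[OF J D_field[OF X Z]]]
      by (simp add: cov_deriv_endo_def)
  qed
qed


section \<open>Integrability of parallel complex structures\<close>

text \<open>
  Expressing the brackets by the connection and moving \<open>J\<close> out of the derivatives turns
  \<open>N\<^sub>J(X,Y)\<close> into \<open>J (\<nabla>\<^bsub>JX\<^esub> Y - \<nabla>\<^bsub>JY\<^esub> X) - J (\<nabla>\<^bsub>JX\<^esub> Y - J \<nabla>\<^sub>Y X) - J (J \<nabla>\<^sub>X Y - \<nabla>\<^bsub>JY\<^esub> X)
  - (\<nabla>\<^sub>X Y - \<nabla>\<^sub>Y X)\<close>, which is 0 because of \<open>J\<^sup>2 = -1\<close>.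
\<close>

lemma integrable_if_parallel:
  assumes J: "complex_structure A J" and D: "affine_connection A D"
    and torsion: "\<And>X Y. X \<in> vector_fields A \<Longrightarrow> Y \<in> vector_fields A \<Longrightarrow>
      D X Y - D Y X = lie_bracket X Y"
    and parallel: "\<And>X Y. X \<in> vector_fields A \<Longrightarrow> Y \<in> vector_fields A \<Longrightarrow>
      cov_deriv_endo D J X Y = 0"
  shows "integrable A J"
  unfolding integrable_def
proof (intro ballI)
  fix X Y
  assume X: "X \<in> vector_fields A" and Y: "Y \<in> vector_fields A"
  have endo: "smooth_endo A J"
    using J by (simp add: complex_structure_def)
  have J_field: "endo_app J P \<in> vector_fields A" if "P \<in> vector_fields A" for P
    using endo that by (rule smooth_endo_vector_field)
  have D_field: "D P Q \<in> vector_fields A" if "P \<in> vector_fields A" "Q \<in> vector_fields A" for P Q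
    using D that by (auto simp: affine_connection_def)
  have commute: "D P (endo_app J Q) = endo_app J (D P Q)"
    if "P \<in> vector_fields A" "Q \<in> vector_fields A" for P Q
    using parallel[OF that] by (simp add: cov_deriv_endo_def)
  have square: "endo_app J (endo_app J P) = - P" if "P \<in> vector_fields A" for P
    using J vector_field_tangent[OF that] by (simp add: complex_structure_def endo_app_def fun_eq_iff)
  show "nijenhuis J X Y = 0"
    by (simp add: nijenhuis_def torsion[symmetric] commute endo_app_diff[OF endo] square
        X Y J_field D_field)
qed

theorem theorem4p4:
  fixes A :: "('a::{t2_space, second_countable_topology}, 'e::real_normed_vector) chart set"
    and \<kappa> :: "'a tensor2" and J :: "'a endo" and D :: "'a connection"
  assumes "smooth_atlas A"
    and "symplectic_form A \<kappa>"
    and "complex_structure A J"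
    and "calibrated A \<kappa> J"
    and "levi_civita A (metric_of \<kappa> J) D"
    and "\<forall>X\<in>vector_fields A. \<forall>Y\<in>vector_fields A. \<forall>Z\<in>vector_fields A.
           cov_deriv_endo D J X (D Y Z) = 0"
  shows "kaehler_structure A (metric_of \<kappa> J) J \<kappa>"
proof -
  have D: "affine_connection A D"
    and torsion: "\<And>X Y. X \<in> vector_fields A \<Longrightarrow> Y \<in> vector_fields A \<Longrightarrow>
      D X Y - D Y X = lie_bracket X Y"
    using assms(5) by (auto simp: levi_civita_def)
  have "smooth_endo A J"
    using assms(3) by (simp add: complex_structure_def)
  with assms(1,6) D have "cov_deriv_endo D J X Y = 0"
    if "X \<in> vector_fields A" "Y \<in> vector_fields A" for X Y
    using parallel_if_kills_derivatives that by blast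
  then have "integrable A J"
    using integrable_if_parallel assms(3) D torsion by blast
  then show ?thesis
    using assms(2-4) by (simp add: kaehler_structure_def)
qed

end
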